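(* Let $n\in\mathbb{N}$ and let $f_1,f_2,\dots,f_n\in F[x]$ be polynomials such that $1,f_1,f_2,\dots,f_n$ are linearly independent over $F$. Fix an open set $U\subseteq F$ and consider the map $\mathbf{f}:U\to F^n$, $\mathbf{f}(x)=(f_1(x),f_2(x),\dots,f_n(x))$. Then there exists $\varepsilon_0>0$ such that for every $\varepsilon\in(0,\tfrac1e]$ with $\varepsilon<\varepsilon_0$, the vector $\mathbf{f}(x)$ is not Dirichlet $\varepsilon$-improvable for $\lambda$-almost every $x\in U$.
   Context: Let $\mathbb{F}_q$ be the finite field with $q$ elements ($q$ a power of a prime), $\Lambda=\mathbb{F}_q[T]$, and $F=\mathbb{F}_q((T^{-1}))$ the field of formal Laurent series in $T^{-1}$. For nonzero $a=\sum_{k\le k_0}a_kT^k\in F$ with $a_k\in\mathbb{F}_q$, $a_{k_0}\ne0$, put $\deg a=k_0$ and $|a|=e^{\deg a}$; put $|0|=0$. This is a non-archimedean absolute value, and $F$ carries the resulting topology. $\lambda$ is a fixed Haar measure on $F$. Let $0<\varepsilon\le\frac1e$. A vector $\mathbf{y}=(y_1,\dots,y_n)\in F^n$ is called Dirichlet $\varepsilon$-improvable if there is $t_0>0$ such that for any choice of $n$ nonnegative integers $t_1,\dots,t_n$ with $\max\{t,t_1,\dots,t_n\}>t_0$, where $t=t_1+\dots+t_n$, there exists a nonzero $(p,q_1,\dots,q_n)\in\Lambda\times\Lambda^n$ satisfying $$|y_1q_1+\dots+y_nq_n-p|<\frac{\varepsilon}{e^{t}}\quad\text{and}\quad |q_j|<\varepsilon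 e^{t_j}\ \text{ for } j=1,\dots,n.$$ *)

theory Defs
  imports
    "HOL-Analysis.Analysis"
    "HOL-Computational_Algebra.Formal_Laurent_Series"
begin

text \<open>
  For a finite field \<open>'a\<close>, the type \<open>'a fls\<close> is the field of formal Laurent series over \<open>'a\<close> in
  the variable \<open>X = 1/T\<close>. Hence \<open>T\<close> is \<^const>\<open>fls_X_inv\<close> and \<open>deg a = - fls_subdegree a\<close> for
  nonzero \<open>a\<close>.
\<close>

definition fls_abs :: "'a::zero fls \<Rightarrow> real" where
  "fls_abs a = (if a = 0 then 0 else exp (- real_of_int (fls_subdegree a)))"

text \<open>
  The library metric on \<open>'a fls\<close> uses base 2 in place of base \<open>e\<close>; the topology is the same.
\<close>

lemma fls_abs_less_exp_iff:
  fixes a b :: "'a::group_add fls" and m :: int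
  shows "fls_abs (a - b) < exp (real_of_int m) \<longleftrightarrow> dist a b < 2 powi m"
proof (cases "a = b")
  case True
  then show ?thesis by (simp add: fls_abs_def)
next
  case False
  have d: "dist a b = 2 powi (- fls_subdegree (a - b))"
    using False by (simp add: dist_fls_def power_int_def power_one_over inverse_eq_divide)
  have "(2::real) powi k < 2 powi l \<longleftrightarrow> k < l" for k l :: int
    using power_int_strict_increasing[of k l "2::real"] power_int_increasing[of l k "2::real"]
    by linarith
  then show ?thesis
    using False unfolding fls_abs_def d by (simp del: of_int_minus add: of_int_minus[symmetric])
qed

lemma open_fls_iff_fls_abs:
  fixes S :: "'a::group_add fls set"
  shows "open S \<longleftrightarrow> (\<forall>a\<in>S. \<exists>r>0. {y. fls_abs (y - a) < r} \<subseteq> S)"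
proof -
  have "(\<exists>r>0. {y. dist y a < r} \<subseteq> S) \<longleftrightarrow> (\<exists>r>0. {y. fls_abs (y - a) < r} \<subseteq> S)" for a
  proof
    assume "\<exists>r>0. {y. dist y a < r} \<subseteq> S"
    then obtain r where r: "r > 0" "{y. dist y a < r} \<subseteq> S" by blast
    obtain k :: nat where k: "(1/2) ^ k < r"
      using real_arch_pow_inv[of r "1/2"] r(1) by auto
    have eq: "(2::real) powi (- int k) = (1/2) ^ k"
      by (simp add: power_int_minus power_one_over inverse_eq_divide)
    have "{y. fls_abs (y - a) < exp (real_of_int (- int k))} \<subseteq> S"
      using r(2) k by (auto simp only: fls_abs_less_exp_iff eq)
    then show "\<exists>r>0. {y. fls_abs (y - a) < r} \<subseteq> S" using exp_gt_zero by blast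
  next
    assume "\<exists>r>0. {y. fls_abs (y - a) < r} \<subseteq> S"
    then obtain r where r: "r > 0" "{y. fls_abs (y - a) < r} \<subseteq> S" by blast
    have le: "exp (real_of_int \<lfloor>ln r\<rfloor>) \<le> r"
      using r(1) by (metis exp_le_cancel_iff exp_ln of_int_floor_le)
    have "{y. dist y a < 2 powi \<lfloor>ln r\<rfloor>} \<subseteq> S"
      unfolding fls_abs_less_exp_iff[symmetric] using r(2) le by auto
    then show "\<exists>r>0. {y. dist y a < r} \<subseteq> S"
      by (metis zero_less_power_int zero_less_numeral)
  qed
  then show ?thesis unfolding open_fls_def by simp
qed

text \<open>The embedding of the polynomial ring in \<open>T\<close>; note that \<open>T\<close> is the inverse of the variable
  of \<open>'a fls\<close>.\<close>

definition poly_to_fls :: "'a::comm_ring_1 poly \<Rightarrow> 'a fls" where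
  "poly_to_fls p = poly (map_poly fls_const p) fls_X_inv"

lemma poly_to_fls_nth:
  "fls_nth (poly_to_fls p) k = (if k \<le> 0 then coeff p (nat (- k)) else 0)"
proof (induction p arbitrary: k rule: pCons_induct)
  case 0
  then show ?case by (simp add: poly_to_fls_def)
next
  case (pCons a p)
  have *: "poly_to_fls (pCons a p) = fls_const a + fls_X_inv * poly_to_fls p"
    by (simp add: poly_to_fls_def map_poly_pCons)
  consider "k > 0" | "k = 0" | "k < 0" by linarith
  then show ?case
  proof cases
    case 3
    then obtain m where m: "nat (- k) = Suc m" using zero_less_nat_eq
      by (metis gr0_implies_Suc neg_0_less_iff_less)
    then have "nat (- k - 1) = m" by linarith
    then show ?thesis using 3 m
      by (simp add: * fls_X_inv_times_conv_shift pCons.IH)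
  qed (simp_all add: * fls_X_inv_times_conv_shift pCons.IH)
qed

text \<open>
  Regularity is not required: \<open>'a fls\<close> is locally compact and separable for finite \<open>'a\<close>, so a
  Borel measure that is finite on compact sets is automatically regular.
\<close>

definition haar_measure :: "'a::{group_add, topological_space} measure \<Rightarrow> bool" where
  "haar_measure M \<longleftrightarrow>
     sets M = sets borel \<and>
     (\<forall>c. \<forall>A\<in>sets borel. emeasure M ((\<lambda>x. c + x) ` A) = emeasure M A) \<and>
     (\<forall>K. compact K \<longrightarrow> emeasure M K < \<infinity>) \<and>
     (\<forall>V. open V \<and> V \<noteq> {} \<longrightarrow> emeasure M V > 0)"

definition dirichlet_improvable ::
    "real \<Rightarrow> ('a::{field, finite} fls) ^ 'n \<Rightarrow> bool" where
  "dirichlet_improvable \<epsilon> y \<longleftrightarrow>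
     (\<exists>t0::real. t0 > 0 \<and>
       (\<forall>t :: 'n \<Rightarrow> nat.
          real (Max (insert (\<Sum>j\<in>UNIV. t j) (range t))) > t0 \<longrightarrow>
          (\<exists>(p :: 'a poly) (q :: 'a poly ^ 'n).
             (p, q) \<noteq> (0, 0) \<and>
             fls_abs ((\<Sum>j\<in>UNIV. y $ j * poly_to_fls (q $ j)) - poly_to_fls p)
               < \<epsilon> / exp (real (\<Sum>j\<in>UNIV. t j)) \<and>
             (\<forall>j. fls_abs (poly_to_fls (q $ j)) < \<epsilon> * exp (real (t j))))))"

end

theory Submission
  imports Defs
begin

text \<open>
  The vector of degrees \<open>t = (0, \<dots>, s, \<dots>, 0)\<close>, with \<open>s\<close> in position \<open>i\<close>, is admissible in the
  definition of improvability. For it the bound \<open>\<bar>q\<^sub>j\<bar> < \<epsilon> < 1\<close> forces \<open>q\<^sub>j = 0\<close> whenever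
  \<open>j \<noteq> i\<close>, so an improvable vector has improvable coordinates, in the one-dimensional sense
  (\<open>dirichlet_improvable_imp_rational_coordinate\<close>).

  In dimension one, improvability with \<open>\<epsilon> \<le> 1/e\<close> already forces rationality, by the classical
  determinant argument of Khinchin (\<open>rational_fls_if_uniformly_approximable\<close>). If \<open>(p, q)\<close> and
  \<open>(p', q')\<close> solve the system for \<open>s\<close> and \<open>s + 1\<close>, the polynomial \<open>p q' - p' q\<close> has absolute value
  below \<open>\<epsilon>\<^sup>2 e < 1\<close>, hence vanishes. So all the fractions \<open>p/q\<close> coincide, and their common
  value, being arbitrarily close to \<open>y\<close>, is \<open>y\<close>.

  There are only countably many rational elements of \<open>F\<close>, and a nonconstant polynomial takes each
  of them finitely often. Linear independence of \<open>1, f\<^sub>1, \<dots>, f\<^sub>n\<close> makes \<open>f\<^sub>i\<close> nonconstant, so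
  \<open>f(x)\<close> can be improvable for only countably many \<open>x\<close>, and countable sets are null for a Haar
  measure of \<open>F\<close> because points are (\<open>haar_measure_singleton\<close>). The argument is uniform in
  \<open>\<epsilon> \<le> 1/e\<close>, so any \<open>\<epsilon>\<^sub>0 > 0\<close> will do.
\<close>

section \<open>Polynomials inside the Laurent series field\<close>

lemma poly_to_fls_pCons: "poly_to_fls (pCons a p) = fls_const a + fls_X_inv * poly_to_fls p"
  by (simp add: poly_to_fls_def map_poly_pCons)

lemma poly_to_fls_0 [simp]: "poly_to_fls 0 = 0"
  by (simp add: poly_to_fls_def)

lemma poly_to_fls_diff: "poly_to_fls (p - q) = poly_to_fls p - poly_to_fls q"
  by (rule fls_eqI) (simp add: poly_to_fls_nth)

lemma poly_to_fls_add: "poly_to_fls (p + q) = poly_to_fls p + poly_to_fls q"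
  by (rule fls_eqI) (simp add: poly_to_fls_nth)

lemma poly_to_fls_smult: "poly_to_fls (smult a p) = fls_const a * poly_to_fls p"
  by (rule fls_eqI) (simp add: poly_to_fls_nth)

lemma poly_to_fls_mult: "poly_to_fls (p * q) = poly_to_fls p * poly_to_fls q"
  by (induction p rule: pCons_induct)
     (simp_all add: mult_pCons_left poly_to_fls_add poly_to_fls_smult poly_to_fls_pCons algebra_simps)

lemma poly_to_fls_eq_0_iff [simp]: "poly_to_fls p = 0 \<longleftrightarrow> p = 0"
proof
  assume "poly_to_fls p = 0"
  then have "coeff p k = 0" for k
    using poly_to_fls_nth[of p "- int k"] by simp
  then show "p = 0" by (simp add: poly_eq_iff)
qed simp

lemma fls_abs_nonneg: "fls_abs a \<ge> 0"
  by (simp add: fls_abs_def)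

lemma fls_abs_minus [simp]: "fls_abs (- a) = fls_abs (a :: 'a::group_add fls)"
  by (simp add: fls_abs_def)

lemma fls_abs_mult: "fls_abs (a * b) = fls_abs a * fls_abs (b :: 'a::idom fls)"
  by (simp add: fls_abs_def exp_add [symmetric])

text \<open>The ultrametric inequality, in the form of closure of open balls around \<open>0\<close> under
  subtraction.\<close>

lemma fls_abs_diff_less:
  fixes a b :: "'a::group_add fls"
  assumes "fls_abs a < r" "fls_abs b < r"
  shows "fls_abs (a - b) < r"
proof (cases "a = 0 \<or> b = 0 \<or> a - b = 0")
  case True
  have "0 < r" using assms(1) fls_abs_nonneg[of a] by linarith
  then show ?thesis using True assms by (auto simp: fls_abs_def)
next
  case False
  then have "fls_subdegree (a - b) \<ge> min (fls_subdegree a) (fls_subdegree b)"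
    using fls_subdegree_minus[of a b] by auto
  then have "fls_abs (a - b) \<le> max (fls_abs a) (fls_abs b)"
    using False by (auto simp: fls_abs_def le_max_iff_disj min_le_iff_disj)
  then show ?thesis using assms by linarith
qed

text \<open>Discreteness of \<open>\<Lambda>\<close> in \<open>F\<close>: this is what turns a small polynomial into zero.\<close>

lemma fls_abs_poly_to_fls_ge_1:
  assumes "p \<noteq> 0"
  shows "fls_abs (poly_to_fls p) \<ge> 1"
proof -
  have "fls_nth (poly_to_fls p) (fls_subdegree (poly_to_fls p)) \<noteq> 0"
    using assms by simp
  then have "fls_subdegree (poly_to_fls p) \<le> 0"
    by (metis poly_to_fls_nth)
  then show ?thesis using assms by (simp add: fls_abs_def)
qed

section \<open>Uniformly good approximation forces rationality\<close>

definition rational_fls :: "'a::field fls \<Rightarrow> bool" where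
  "rational_fls y \<longleftrightarrow> (\<exists>p q. y = poly_to_fls p / poly_to_fls q)"

text \<open>Consecutive approximations have a determinant of absolute value less than \<open>1\<close>, so they
  represent the same fraction; a single fraction approximating \<open>y\<close> at every scale equals \<open>y\<close>.\<close>

lemma rational_fls_if_uniformly_approximable:
  fixes y :: "'a::field fls"
  assumes "0 < \<epsilon>" "\<epsilon> \<le> 1 / exp 1"
    and approx: "\<And>s. s \<ge> s0 \<Longrightarrow> \<exists>p q. q \<noteq> 0
        \<and> fls_abs (y * poly_to_fls q - poly_to_fls p) < \<epsilon> / exp (real s)
        \<and> fls_abs (poly_to_fls q) < \<epsilon> * exp (real s)"
  shows "rational_fls y"
proof -
  obtain P Q where PQ: "\<And>s. s \<ge> s0 \<Longrightarrow> Q s \<noteq> 0"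
    "\<And>s. s \<ge> s0 \<Longrightarrow> fls_abs (y * poly_to_fls (Q s) - poly_to_fls (P s)) < \<epsilon> / exp (real s)"
    "\<And>s. s \<ge> s0 \<Longrightarrow> fls_abs (poly_to_fls (Q s)) < \<epsilon> * exp (real s)"
    using approx by metis
  define err where "err s = y * poly_to_fls (Q s) - poly_to_fls (P s)" for s
  have eps: "\<epsilon> * \<epsilon> * exp 1 \<le> 1" "\<epsilon> * \<epsilon> * inverse (exp 1) \<le> 1"
  proof -
    have e: "\<epsilon> * exp 1 \<le> 1" using assms(2) by (simp add: field_simps)
    have "\<epsilon> \<le> \<epsilon> * exp 1" using assms(1) by simp
    with e have l: "\<epsilon> \<le> 1" by linarith
    have ll: "\<epsilon> * \<epsilon> \<le> 1" using mult_mono[OF l l] assms(1) by simp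
    show "\<epsilon> * \<epsilon> * exp 1 \<le> 1"
      using mult_mono[OF l e] assms(1) by (simp add: mult.assoc)
    show "\<epsilon> * \<epsilon> * inverse (exp 1) \<le> 1"
      using mult_mono[OF ll, of "inverse (exp 1)" 1] assms(1) by (simp add: exp_minus [symmetric])
  qed
  have cross_eq: "P s * Q (Suc s) = P (Suc s) * Q s" if s: "s \<ge> s0" for s
  proof (rule ccontr)
    assume "P s * Q (Suc s) \<noteq> P (Suc s) * Q s"
    then have ge: "fls_abs (poly_to_fls (P s * Q (Suc s) - P (Suc s) * Q s)) \<ge> 1"
      by (intro fls_abs_poly_to_fls_ge_1) simp
    have S: "Suc s \<ge> s0" using s by simp
    \<comment> \<open>The terms in \<open>y\<close> cancel, so the determinant is a combination of the two small errors.\<close>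
    have det: "poly_to_fls (P s * Q (Suc s) - P (Suc s) * Q s)
        = poly_to_fls (Q s) * err (Suc s) - poly_to_fls (Q (Suc s)) * err s"
      by (simp add: err_def poly_to_fls_diff poly_to_fls_mult algebra_simps)
    have "fls_abs (poly_to_fls (Q (Suc s)) * err s) < (\<epsilon> * exp (real (Suc s))) * (\<epsilon> / exp (real s))"
      unfolding fls_abs_mult err_def
      by (rule mult_strict_mono[OF PQ(3)[OF S] PQ(2)[OF s]])
         (simp_all add: assms(1) fls_abs_nonneg)
    also have "\<dots> = \<epsilon> * \<epsilon> * exp 1" by (simp add: exp_add)
    finally have 1: "fls_abs (poly_to_fls (Q (Suc s)) * err s) < 1" using eps by linarith
    have "fls_abs (poly_to_fls (Q s) * err (Suc s)) < (\<epsilon> * exp (real s)) * (\<epsilon> / exp (real (Suc s)))"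
      unfolding fls_abs_mult err_def
      by (rule mult_strict_mono[OF PQ(3)[OF s] PQ(2)[OF S]])
         (simp_all add: assms(1) fls_abs_nonneg)
    also have "\<dots> = \<epsilon> * \<epsilon> * inverse (exp 1)" by (simp add: exp_add field_simps)
    finally have 2: "fls_abs (poly_to_fls (Q s) * err (Suc s)) < 1" using eps by linarith
    show False using ge fls_abs_diff_less[OF 2 1] by (simp add: det)
  qed
  define r where "r = poly_to_fls (P s0) / poly_to_fls (Q s0)"
  have const: "poly_to_fls (P s) / poly_to_fls (Q s) = r" if "s \<ge> s0" for s
    using that
  proof (induction rule: dec_induct)
    case base
    then show ?case by (simp add: r_def)
  next
    case (step s)
    have "poly_to_fls (P s) * poly_to_fls (Q (Suc s)) = poly_to_fls (P (Suc s)) * poly_to_fls (Q s)"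
      using step.hyps cross_eq[of s]
      by (simp flip: poly_to_fls_mult)
    then show ?case
      using step PQ(1)[of s] PQ(1)[of "Suc s"] by (simp add: frac_eq_eq flip: step.IH)
  qed
  \<comment> \<open>Dividing the error by \<open>Q s\<close> loses nothing, since \<open>\<bar>Q s\<bar> \<ge> 1\<close>.\<close>
  have small: "fls_abs (y - r) < \<epsilon> / exp (real s)" if s: "s \<ge> s0" for s
  proof -
    have "err s = (y - r) * poly_to_fls (Q s)"
      using PQ(1)[OF s] by (simp add: err_def const[OF s, symmetric] field_simps)
    then have "fls_abs (err s) = fls_abs (y - r) * fls_abs (poly_to_fls (Q s))"
      by (simp add: fls_abs_mult)
    moreover have "fls_abs (y - r) * 1 \<le> fls_abs (y - r) * fls_abs (poly_to_fls (Q s))"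
      by (intro mult_left_mono fls_abs_poly_to_fls_ge_1 PQ s fls_abs_nonneg)
    ultimately show ?thesis using PQ(2)[OF s] by (simp add: err_def)
  qed
  have "y = r"
  proof (rule ccontr)
    assume "y \<noteq> r"
    then have pos: "fls_abs (y - r) > 0" by (simp add: fls_abs_def)
    obtain m :: nat where m: "\<epsilon> / fls_abs (y - r) < real m" using reals_Archimedean2 by blast
    define s where "s = max s0 m"
    have "m \<le> s" by (simp add: s_def)
    have "\<epsilon> / fls_abs (y - r) < exp (real s)"
      using m exp_ge_add_one_self[of "real s"] \<open>m \<le> s\<close> by linarith
    then have "\<epsilon> / exp (real s) < fls_abs (y - r)"
      using pos by (simp add: field_simps)
    then show False using small[of s] by (simp add: s_def)
  qed
  then show ?thesis unfolding rational_fls_def r_def by blast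
qed

text \<open>Putting the whole degree \<open>s\<close> on the coordinate \<open>i\<close> kills all the other \<open>q\<^sub>j\<close>, so what
  remains is approximation of the single series \<open>y\<^sub>i\<close>, at every large scale \<open>s\<close>.\<close>

lemma dirichlet_improvable_imp_rational_coordinate:
  fixes y :: "('a::{field, finite} fls) ^ 'n"
  assumes eps: "0 < \<epsilon>" "\<epsilon> \<le> 1 / exp 1" and imp: "dirichlet_improvable \<epsilon> y"
  shows "rational_fls (y $ i)"
proof -
  have eps1: "\<epsilon> \<le> 1"
    using eps(2) by (rule order_trans) simp
  obtain t0 where t0: "\<And>t. t0 < real (Max (insert (\<Sum>j\<in>UNIV. t j) (range t))) \<Longrightarrow>
      \<exists>p q. (p, q) \<noteq> (0, 0) \<and>
        fls_abs ((\<Sum>j\<in>UNIV. y $ j * poly_to_fls (q $ j)) - poly_to_fls p)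
          < \<epsilon> / exp (real (\<Sum>j\<in>UNIV. t j)) \<and>
        (\<forall>j. fls_abs (poly_to_fls (q $ j)) < \<epsilon> * exp (real (t j)))"
    using imp unfolding dirichlet_improvable_def by blast
  obtain s0 :: nat where s0: "t0 < real s0" using reals_Archimedean2 by blast
  show ?thesis
  proof (rule rational_fls_if_uniformly_approximable[OF eps, of s0])
    fix s :: nat
    assume s: "s0 \<le> s"
    define t where "t = (\<lambda>j. if j = i then s else 0)"
    have sum_t: "(\<Sum>j\<in>UNIV. t j) = s" by (simp add: t_def)
    have "s \<le> Max (insert (\<Sum>j\<in>UNIV. t j) (range t))"
      unfolding sum_t by (rule Max_ge) auto
    with s s0 have "real (Max (insert (\<Sum>j\<in>UNIV. t j) (range t))) > t0" by linarith
    from t0[OF this] obtain p q where pq: "(p, q) \<noteq> (0, 0)"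
      "fls_abs ((\<Sum>j\<in>UNIV. y $ j * poly_to_fls (q $ j)) - poly_to_fls p) < \<epsilon> / exp (real s)"
      and q: "\<And>j. fls_abs (poly_to_fls (q $ j)) < \<epsilon> * exp (real (t j))"
      unfolding sum_t by blast
    have q0: "q $ j = 0" if "j \<noteq> i" for j
    proof (rule ccontr)
      assume "q $ j \<noteq> 0"
      then have "1 \<le> fls_abs (poly_to_fls (q $ j))" by (rule fls_abs_poly_to_fls_ge_1)
      moreover have "fls_abs (poly_to_fls (q $ j)) < \<epsilon>" using q[of j] that by (simp add: t_def)
      ultimately show False using eps1 by linarith
    qed
    have "(\<Sum>j\<in>UNIV. y $ j * poly_to_fls (q $ j)) = (\<Sum>j\<in>{i}. y $ j * poly_to_fls (q $ j))"
      by (rule sum.mono_neutral_right) (auto simp: q0)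
    then have a: "fls_abs (y $ i * poly_to_fls (q $ i) - poly_to_fls p) < \<epsilon> / exp (real s)"
      using pq(2) by simp
    \<comment> \<open>Otherwise \<open>q = 0\<close>, so \<open>p \<noteq> 0\<close> would be a polynomial of absolute value below \<open>1\<close>.\<close>
    have "q $ i \<noteq> 0"
    proof
      assume qi: "q $ i = 0"
      then have "q = 0" using q0 by (metis vec_eq_iff zero_index)
      with pq(1) have "p \<noteq> 0" by simp
      then have "fls_abs (poly_to_fls p) \<ge> 1"
        by (rule fls_abs_poly_to_fls_ge_1)
      moreover have "\<epsilon> / exp (real s) \<le> 1"
        using eps1 by (simp add: divide_le_eq order_trans[OF eps1])
      moreover have "fls_abs (poly_to_fls p) < \<epsilon> / exp (real s)"
        using a by (simp add: qi)
      ultimately show False by linarith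
    qed
    then show "\<exists>p q'. q' \<noteq> 0 \<and> fls_abs (y $ i * poly_to_fls q' - poly_to_fls p) < \<epsilon> / exp (real s)
        \<and> fls_abs (poly_to_fls q') < \<epsilon> * exp (real s)"
      using a q[of i] by (auto simp: t_def)
  qed
qed

section \<open>The exceptional set is countable\<close>

lemma countable_rational_fls: "countable {y :: 'a::{field, countable} fls. rational_fls y}"
proof -
  have "countable (UNIV :: 'a poly set)"
    by (rule countableI'[where f = "to_nat \<circ> coeffs"]) (auto simp: inj_def coeffs_eq_iff)
  then have "countable ((\<lambda>(p, q). poly_to_fls p / poly_to_fls q :: 'a fls) ` (UNIV \<times> UNIV))"
    by (intro countable_image countable_SIGMA)
  then show ?thesis
    by (rule countable_subset[rotated]) (auto simp: rational_fls_def)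
qed

lemma countable_poly_vimage:
  fixes g :: "'a::idom poly"
  assumes "countable A" "degree g \<noteq> 0"
  shows "countable {x. poly g x \<in> A}"
proof -
  have "countable (\<Union>a\<in>A. {x. poly (g - [:a:]) x = 0})"
  proof (intro countable_UN assms(1) countable_finite poly_roots_finite notI)
    fix a assume "g - [:a:] = 0"
    then show False using assms(2) by simp
  qed
  then show ?thesis by (rule countable_subset[rotated]) auto
qed

section \<open>Countable sets are null for a Haar measure\<close>

lemma fls_X_power_tendsto_0: "(\<lambda>n. fls_X ^ n :: 'a::idom fls) \<longlonglongrightarrow> 0"
proof -
  have "dist (fls_X ^ n :: 'a fls) 0 = (1/2) ^ n" for n
    by (simp add: dist_fls_def power_one_over inverse_eq_divide)
  then show ?thesis
    by (subst tendsto_dist_iff) (simp add: LIMSEQ_realpow_zero)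
qed

text \<open>A member of the cover that contains the limit absorbs all but finitely many terms.\<close>

lemma compact_insert_limit_range:
  fixes f :: "nat \<Rightarrow> 'a::topological_space"
  assumes "f \<longlonglongrightarrow> l"
  shows "compact (insert l (range f))"
proof (rule compactI)
  fix C
  assume C: "\<forall>t\<in>C. open t" "insert l (range f) \<subseteq> \<Union>C"
  then obtain B where B: "B \<in> C" "l \<in> B" by blast
  with C(1) assms have "eventually (\<lambda>n. f n \<in> B) sequentially"
    by (simp add: tendsto_def)
  then obtain N where N: "\<And>n. n \<ge> N \<Longrightarrow> f n \<in> B"
    unfolding eventually_sequentially by blast
  have "\<forall>n. \<exists>G. G \<in> C \<and> f n \<in> G" using C(2) by blast
  then obtain G where G: "\<And>n. G n \<in> C" "\<And>n. f n \<in> G n" by metis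
  have "f n \<in> \<Union>(insert B (G ` {..<N}))" for n
    using N[of n] G(2)[of n] by (cases "n < N") auto
  then have "insert l (range f) \<subseteq> \<Union>(insert B (G ` {..<N}))"
    using B(2) by blast
  moreover have "insert B (G ` {..<N}) \<subseteq> C" using B(1) G(1) by blast
  ultimately show "\<exists>C'\<subseteq>C. finite C' \<and> insert l (range f) \<subseteq> \<Union>C'"
    by (intro exI[of _ "insert B (G ` {..<N})"]) simp
qed

text \<open>All points have the same measure by translation invariance, and a positive common value
  would give infinite measure to every infinite compact set, such as \<open>X\<^sup>n \<longlonglongrightarrow> 0\<close> together with
  its limit.\<close>

lemma haar_measure_singleton:
  fixes M :: "'a::idom fls measure"
  assumes "haar_measure M"
  shows "emeasure M {a} = 0"
proof (rule ccontr)
  assume nz: "emeasure M {a} \<noteq> 0"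
  have sets: "sets M = sets borel"
    and inv: "\<And>c A. A \<in> sets borel \<Longrightarrow> emeasure M ((+) c ` A) = emeasure M A"
    and fin: "\<And>K. compact K \<Longrightarrow> emeasure M K < \<infinity>"
    using assms by (simp_all add: haar_measure_def)
  have eq: "emeasure M {x} = emeasure M {a}" for x
    using inv[of "{a}" "x - a"] by simp
  define K where "K = insert 0 (range (\<lambda>n. fls_X ^ n :: 'a fls))"
  have "compact K"
    unfolding K_def by (rule compact_insert_limit_range[OF fls_X_power_tendsto_0])
  have "inj (\<lambda>n. fls_X ^ n :: 'a fls)"
    by (rule injI) (drule arg_cong[where f = fls_subdegree], simp)
  then have inf: "infinite K"
    unfolding K_def using range_inj_infinite by simp
  have "emeasure M K = (\<integral>\<^sup>+x. emeasure M {x} \<partial>count_space K)"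
    by (rule emeasure_countable_singleton) (auto simp: sets K_def)
  also have "\<dots> = (\<integral>\<^sup>+x. emeasure M {a} \<partial>count_space K)"
    by (intro nn_integral_cong eq)
  also have "\<dots> = \<infinity>"
    using nz inf by (simp add: ennreal_mult_top)
  finally show False using fin[OF \<open>compact K\<close>] by simp
qed

section \<open>Polynomial curves are almost nowhere improvable\<close>

theorem theorem1p2:
  fixes f :: "(('a::{field, finite}) fls poly) ^ 'n"
    and U :: "'a fls set"
    and lambda :: "'a fls measure"
  assumes haar: "haar_measure lambda"
    and indep: "\<And>(c0 :: 'a fls) (c :: 'n \<Rightarrow> 'a fls).
          smult c0 1 + (\<Sum>j\<in>UNIV. smult (c j) (f $ j)) = 0 \<Longrightarrow> c0 = 0 \<and> (\<forall>j. c j = 0)"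
    and U: "open U"
  shows "\<exists>\<epsilon>0::real. \<epsilon>0 > 0 \<and>
           (\<forall>\<epsilon>::real. 0 < \<epsilon> \<and> \<epsilon> \<le> 1 / exp 1 \<and> \<epsilon> < \<epsilon>0 \<longrightarrow>
              (AE x in lambda. x \<in> U \<longrightarrow>
                 \<not> dirichlet_improvable \<epsilon> (\<chi> j. poly (f $ j) x)))"
proof -
  \<comment> \<open>Any coordinate will do; irrationality of one of them already excludes improvability.\<close>
  fix i :: 'n
  have deg: "degree (f $ i) \<noteq> 0"
  proof
    assume "degree (f $ i) = 0"
    then obtain a where a: "f $ i = [:a:]" by (rule degree_eq_zeroE)
    define c :: "'n \<Rightarrow> 'a fls" where "c j = (if j = i then 1 else 0)" for j
    have "(\<Sum>j\<in>UNIV. smult (c j) (f $ j)) = (\<Sum>j\<in>UNIV. if j = i then f $ i else 0)"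
      by (rule sum.cong) (auto simp: c_def)
    then have "smult (- a) 1 + (\<Sum>j\<in>UNIV. smult (c j) (f $ j)) = 0"
      by (simp add: a one_pCons)
    then have "c i = 0" using indep by blast
    then show False by (simp add: c_def)
  qed
  define N where "N = {x. rational_fls (poly (f $ i) x)}"
  have "countable N"
    using countable_poly_vimage[OF countable_rational_fls deg] by (simp add: N_def)
  have sets: "sets lambda = sets borel"
    using haar by (simp add: haar_measure_def)
  have "(\<Union>x\<in>N. {x}) \<in> null_sets lambda"
    using \<open>countable N\<close>
    by (rule null_sets_UN') (simp add: null_sets_def sets haar_measure_singleton[OF haar])
  then have null: "N \<in> null_sets lambda" by simp
  have "AE x in lambda. x \<in> U \<longrightarrow> \<not> dirichlet_improvable \<epsilon> (\<chi> j. poly (f $ j) x)"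
    if "0 < \<epsilon>" "\<epsilon> \<le> 1 / exp 1" for \<epsilon>
    using null
  proof (rule AE_I')
    show "{x \<in> space lambda. \<not> (x \<in> U \<longrightarrow> \<not> dirichlet_improvable \<epsilon> (\<chi> j. poly (f $ j) x))} \<subseteq> N"
      using dirichlet_improvable_imp_rational_coordinate[OF that] by (fastforce simp: N_def)
  qed
  then show ?thesis by (intro exI[of _ 1]) simp
qed

end
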